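(* Let $A,B$ and $S$ be non-empty subsets of a finite Abelian group $G$. If $|A|+|B|=|G|+L_S$, then $|A\wedge^S B|\ge |G|-2|S|$.
   Context: Groups are written additively. For subsets $A,B,S$ of a finite Abelian group $G$, the restricted sumset of $A$ and $B$ with respect to $S$ is $A\wedge^S B=\{a+b:\ a\in A,\ b\in B,\ a-b\notin S\}$. For $z\in G$, $L_S(z)=|\{(x,y)\in G\times G:\ x+y=z \text{ and } x-y\in S\}|$, and $L_S=\max_{z\in G}L_S(z)$. *)

theory Defs
  imports Main "HOL-Library.Cardinality"
begin

definition restricted_sumset ::
  "'a::ab_group_add set \<Rightarrow> 'a set \<Rightarrow> 'a set \<Rightarrow> 'a set" where
  "restricted_sumset S A B = {a + b | a b. a \<in> A \<and> b \<in> B \<and> a - b \<notin> S}"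

definition L_at :: "'a::{ab_group_add, finite} set \<Rightarrow> 'a \<Rightarrow> nat" where
  "L_at S z = card {(x, y). x + y = z \<and> x - y \<in> S}"

definition L_max :: "'a::{ab_group_add, finite} set \<Rightarrow> nat" where
  "L_max S = Max (range (L_at S))"

end

theory Submission
  imports Defs
begin

text \<open>
  Let M be the complement of the restricted sumset, C and D the complements of A and B. The
  cardinality hypothesis forces, for each z in M, the group to be the disjoint union of C, z - D
  and X(z) = {x. 2x - z \<in> S}. Fix z0 in M and write F = X(z0); then X(z0 + 2w) = w + F, and it
  suffices to show that W = {w. z0 + 2w \<in> M} has at most 2|F| elements, since averaging over all
  cosets of 2G turns this into |M| \<le> 2|S|. After shrinking C and enlarging D one may assume that
  both are periodic modulo the stabilizer R of F, and then w \<mapsto> z0 + 2w is injective modulo R.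
  A weak form of Kneser's theorem shows that the sums z0 + 2w + r fill at most 2|F| elements, or
  that they lie in a coset of a proper subgroup Q. In the second case one restricts to a coset of Q
  and iterates; this ends with an x lying in all X(z), or a y with z - y in all X(z), and then
  |W| \<le> |F|.
\<close>

section \<open>Subgroups, stabilizers and a weak form of Kneser's theorem\<close>

definition add_subgroup :: "'a::ab_group_add set \<Rightarrow> bool" where
  "add_subgroup H \<longleftrightarrow> 0 \<in> H \<and> (\<forall>x\<in>H. \<forall>y\<in>H. x - y \<in> H)"

lemma add_subgroup_zero: "add_subgroup H \<Longrightarrow> 0 \<in> H"
  by (simp add: add_subgroup_def)

lemma add_subgroup_diff: "add_subgroup H \<Longrightarrow> x \<in> H \<Longrightarrow> y \<in> H \<Longrightarrow> x - y \<in> H"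
  by (simp add: add_subgroup_def)

lemma add_subgroup_minus: "add_subgroup H \<Longrightarrow> x \<in> H \<Longrightarrow> - x \<in> H"
  using add_subgroup_diff[of H 0 x] add_subgroup_zero by auto

lemma add_subgroup_add: "add_subgroup H \<Longrightarrow> x \<in> H \<Longrightarrow> y \<in> H \<Longrightarrow> x + y \<in> H"
  using add_subgroup_diff[of H x "- y"] add_subgroup_minus by auto

definition stabilizer :: "'a::ab_group_add set \<Rightarrow> 'a set" where
  "stabilizer X = {g. \<forall>x. x + g \<in> X \<longleftrightarrow> x \<in> X}"

lemma add_subgroup_stabilizer: "add_subgroup (stabilizer X)"
proof -
  have "x - y \<in> stabilizer X" if "x \<in> stabilizer X" "y \<in> stabilizer X" for x y
  proof -
    have "z + (x - y) \<in> X \<longleftrightarrow> z \<in> X" for z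
    proof -
      have "z + (x - y) \<in> X \<longleftrightarrow> (z + (x - y)) + y \<in> X"
        using that unfolding stabilizer_def by blast
      also have "(z + (x - y)) + y = z + x" by simp
      also have "z + x \<in> X \<longleftrightarrow> z \<in> X" using that unfolding stabilizer_def by blast
      finally show ?thesis .
    qed
    then show ?thesis by (simp add: stabilizer_def)
  qed
  then show ?thesis by (simp add: add_subgroup_def stabilizer_def)
qed

text \<open>A translation is injective, so it cannot map a finite set into a proper part of itself;
  one inclusion is therefore enough.\<close>

lemma stabilizer_if_shift_subset:
  fixes X :: "'a::{ab_group_add, finite} set"
  assumes "\<And>x. x \<in> X \<Longrightarrow> x + g \<in> X"
  shows "g \<in> stabilizer X"
proof -
  have "(\<lambda>x. x + g) ` X = X"
    by (rule card_subset_eq) (use assms in \<open>auto simp: card_image\<close>)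
  then have "x \<in> X" if "x + g \<in> X" for x
    using that by (auto simp: set_eq_iff image_iff) (metis add_right_cancel)
  then show ?thesis using assms unfolding stabilizer_def by blast
qed

lemma card_coset: "card {x. x - u \<in> H} = card (H :: 'a::ab_group_add set)"
proof -
  have "{x. x - u \<in> H} = (\<lambda>h. h + u) ` H"
    by (auto simp: image_iff) (metis diff_add_cancel)
  then show ?thesis by (simp add: card_image)
qed

text \<open>Unlike in Kneser's theorem, the periodic set need not be all of C + D. This is what makes a
  plain induction with the Dyson transform sufficient.\<close>

lemma weak_Kneser:
  fixes C D :: "'a::{ab_group_add, finite} set"
  assumes "C \<noteq> {}" "D \<noteq> {}"
  shows "\<exists>T Q. add_subgroup Q \<and> T \<noteq> {} \<and> (\<forall>t\<in>T. \<exists>c\<in>C. \<exists>d\<in>D. t = c + d) \<and>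
           (\<forall>t\<in>T. \<forall>q\<in>Q. t + q \<in> T) \<and> card C + card D \<le> card T + card Q"
  using assms
proof (induction "card D" arbitrary: C D rule: less_induct)
  case less
  show ?case
  proof (cases "\<exists>c\<in>C. \<exists>d\<in>D. \<exists>d'\<in>D. d' + (c - d) \<notin> C")
    case True
    then obtain c d d' where cd: "c \<in> C" "d \<in> D" "d' \<in> D" "d' + (c - d) \<notin> C" by blast
    \<comment> \<open>Dyson transform: the elements of \<open>D + e\<close> missing from
      \<open>C\<close> move over to \<open>C\<close>, which keeps the total size. With
      \<open>e = c - d\<close>, the element \<open>d\<close> stays in \<open>D'\<close>, so
      \<open>D'\<close> is nonempty, while \<open>d'\<close> leaves it, so it shrinks. No new sums
      arise: for \<open>b\<close> in \<open>D\<close> and \<open>y\<close> in \<open>D'\<close>,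
      \<open>(b + e) + y = (y + e) + b\<close> with \<open>y + e\<close> in
      \<open>C\<close>.\<close>
    define e where "e = c - d"
    define C' where "C' = C \<union> (\<lambda>x. x + e) ` D"
    define D' where "D' = {x \<in> D. x + e \<in> C}"
    have "d \<in> D'" using cd by (simp add: D'_def e_def)
    have "d' \<notin> D'" "D' \<subseteq> D" using cd by (auto simp: D'_def e_def)
    then have lt: "card D' < card D" using cd by (intro psubset_card_mono) auto
    have "C \<inter> (\<lambda>x. x + e) ` D = (\<lambda>x. x + e) ` D'" by (auto simp: D'_def)
    then have "card C' + card D' = card C + card D"
      using card_Un_Int[of C "(\<lambda>x. x + e) ` D"] by (simp add: C'_def card_image)
    moreover have "C' \<noteq> {}" using cd by (auto simp: C'_def)
    moreover obtain T Q where TQ: "add_subgroup Q" "T \<noteq> {}"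
      "\<forall>t\<in>T. \<exists>c\<in>C'. \<exists>d\<in>D'. t = c + d" "\<forall>t\<in>T. \<forall>q\<in>Q. t + q \<in> T"
      "card C' + card D' \<le> card T + card Q"
      using less.hyps[OF lt, of C'] \<open>C' \<noteq> {}\<close> \<open>d \<in> D'\<close> by blast
    moreover have sums: "\<exists>c\<in>C. \<exists>d\<in>D. x + y = c + d" if xy: "x \<in> C'" "y \<in> D'" for x y
    proof (cases "x \<in> C")
      case True
      then show ?thesis using that by (auto simp: D'_def)
    next
      case False
      then obtain b where "b \<in> D" "x = b + e" using xy by (auto simp: C'_def)
      then have "y + e \<in> C" "x + y = (y + e) + b"
        using xy by (auto simp: D'_def algebra_simps)
      then show ?thesis using \<open>b \<in> D\<close> by blast
    qed
    moreover have "\<forall>t\<in>T. \<exists>c\<in>C. \<exists>d\<in>D. t = c + d"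
    proof
      fix t assume "t \<in> T"
      then obtain x y where "x \<in> C'" "y \<in> D'" "t = x + y" using TQ(3) by blast
      then show "\<exists>c\<in>C. \<exists>d\<in>D. t = c + d" using sums by simp
    qed
    ultimately show ?thesis by (intro exI[of _ T] exI[of _ Q]) simp
  next
    case False
    \<comment> \<open>Now every \<open>C + (d' - d)\<close> lies in \<open>C\<close>, so
      \<open>D\<close> lies in a single coset of the stabilizer of \<open>C\<close>. A single
      translate of \<open>C\<close> then serves as the periodic set.\<close>
    obtain d where d: "d \<in> D" using less.prems by blast
    let ?Q = "stabilizer C"
    let ?T = "(\<lambda>c. c + d) ` C"
    have "d' - d \<in> ?Q" if "d' \<in> D" for d'
      by (rule stabilizer_if_shift_subset) (use False d that in \<open>force simp: algebra_simps\<close>)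
    then have "(\<lambda>x. x - d) ` D \<subseteq> ?Q" by auto
    then have "card D \<le> card ?Q"
      by (rule card_inj_on_le[rotated]) (auto simp: inj_on_def)
    moreover have "\<forall>t\<in>?T. \<forall>q\<in>?Q. t + q \<in> ?T"
    proof (intro ballI)
      fix t q assume "t \<in> ?T" "q \<in> ?Q"
      then obtain c where "t = c + d" "c + q \<in> C" by (auto simp: stabilizer_def)
      then have "t + q = (c + q) + d" "c + q \<in> C" by (auto simp: algebra_simps)
      then show "t + q \<in> ?T" by blast
    qed
    moreover have "card ?T = card C" by (simp add: card_image)
    ultimately show ?thesis
      using less.prems d
      by (intro exI[of _ ?T] exI[of _ ?Q]) (auto simp: add_subgroup_stabilizer)
  qed
qed

section \<open>Sets of elements that are not sums from C + D\<close>

text \<open>Stated inside cosets of \<open>H\<close> so that the induction can pass to a proper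
  subgroup. For every \<open>z\<close> in \<open>N\<close> the sets \<open>C\<close> and
  \<open>z - D\<close> are disjoint parts of \<open>u + H\<close>, and \<open>l\<close> counts the
  points of that coset which they leave free. The last two alternatives provide a point that is free
  for all \<open>z\<close> at once, or the reflection \<open>z - y\<close> of a fixed
  \<open>y\<close> that is free for each \<open>z\<close>.\<close>

lemma avoided_sums_bound:
  fixes C D N H :: "'a::{ab_group_add, finite} set"
  assumes "add_subgroup H" and "C \<subseteq> {x. x - u \<in> H}" and "D \<subseteq> {x. x - v \<in> H}"
    and "N \<subseteq> {z. z - (u + v) \<in> H}" and "\<forall>z\<in>N. \<forall>c\<in>C. z - c \<notin> D"
    and "card C + card D + l = card H" and "l > 0"
  shows "card N \<le> 2 * l \<or> (\<exists>x. x - u \<in> H \<and> x \<notin> C \<and> (\<forall>z\<in>N. z - x \<notin> D)) \<or>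
           (\<exists>y. y - v \<in> H \<and> y \<notin> D \<and> (\<forall>z\<in>N. z - y \<notin> C))"
  using assms
proof (induction "card H" arbitrary: H C D u v l rule: less_induct)
  case less
  note H = less.prems(1) and CH = less.prems(2) and DH = less.prems(3) and NH = less.prems(4)
    and avoid = less.prems(5) and cards = less.prems(6) and l = less.prems(7)
  have "\<exists>x. x - u \<in> H \<and> x \<notin> C"
  proof (rule ccontr)
    assume "\<not> ?thesis"
    then have "{x. x - u \<in> H} \<subseteq> C" by auto
    then have "card H \<le> card C" using card_mono[of C] by (metis card_coset finite)
    then show False using cards l by simp
  qed
  \<comment> \<open>With \<open>D\<close> empty, any point of \<open>u + H\<close> outside
    \<open>C\<close> is free for all \<open>z\<close>.\<close>
  then have ?case if "D = {}" using that by blast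
  moreover have "\<exists>y. y - v \<in> H \<and> y \<notin> D"
  proof (rule ccontr)
    assume "\<not> ?thesis"
    then have "{x. x - v \<in> H} \<subseteq> D" by auto
    then have "card H \<le> card D" using card_mono[of D] by (metis card_coset finite)
    then show False using cards l by simp
  qed
  then have ?case if "C = {}" using that by blast
  moreover have ?case if "N = {}" using that by simp
  moreover have ?case if ne: "C \<noteq> {}" "D \<noteq> {}" "N \<noteq> {}"
  proof -
    obtain T Q where Q: "add_subgroup Q" and "T \<noteq> {}"
      and TCD: "\<forall>t\<in>T. \<exists>c\<in>C. \<exists>d\<in>D. t = c + d"
      and TQ: "\<And>t q. t \<in> T \<Longrightarrow> q \<in> Q \<Longrightarrow> t + q \<in> T"
      and card_TQ: "card C + card D \<le> card T + card Q"
      using weak_Kneser[OF ne(1,2)] by blast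
    obtain t where t: "t \<in> T" using \<open>T \<noteq> {}\<close> by blast
    obtain z1 where z1: "z1 \<in> N" using ne by blast
    let ?U = "{z. z - (u + v) \<in> H}"
    have TU: "T \<subseteq> ?U"
    proof
      fix s assume "s \<in> T"
      then obtain c d where cd: "c \<in> C" "d \<in> D" "s = c + d" using TCD by blast
      then have "(c - u) + (d - v) \<in> H" using CH DH add_subgroup_add[OF H] by blast
      then show "s \<in> ?U" using cd by (simp add: algebra_simps)
    qed
    have NT: "N \<inter> T = {}"
    proof -
      have False if z: "z \<in> N" "z \<in> T" for z
      proof -
        obtain c d where cd: "c \<in> C" "d \<in> D" "z = c + d" using TCD z by blast
        then have "z - c = d" by simp
        then show False using avoid z cd by blast
      qed
      then show ?thesis by blast
    qed
    have card_compl: "card (?U - T) + card T = card H"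
      using TU card_Diff_subset[of T ?U] card_mono[of ?U T] card_coset[of "u + v" H] by simp
    have QH: "Q \<subseteq> H"
    proof
      fix q assume "q \<in> Q"
      then have "t + q \<in> ?U" "t \<in> ?U" using TU TQ t by blast+
      then have "(t + q - (u + v)) - (t - (u + v)) \<in> H" using add_subgroup_diff[OF H] by blast
      then show "q \<in> H" by (simp add: algebra_simps)
    qed
    \<comment> \<open>\<open>N\<close> lies in \<open>?U - T\<close>, which has at most
      \<open>l + card Q\<close> elements. If \<open>card Q \<le> l\<close>, this is the bound
      \<open>2 * l\<close>. Otherwise it is less than \<open>2 * card Q\<close>; as
      \<open>?U - T\<close> contains the full \<open>Q\<close>-coset of each element of
      \<open>N\<close>, there is room for only one such coset.\<close>
    show ?case
    proof (cases "card Q \<le> l")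
      case True
      have "card N \<le> card (?U - T)" using NH NT by (intro card_mono) auto
      then show ?thesis using card_compl card_TQ cards True by linarith
    next
      case False
      have coset: "{x. x - z \<in> Q} \<subseteq> ?U - T" if z: "z \<in> N" for z
      proof
        fix x assume "x \<in> {x. x - z \<in> Q}"
        then have x: "x - z \<in> Q" by simp
        then have "(x - z) + (z - (u + v)) \<in> H" using QH NH z add_subgroup_add[OF H] by blast
        then have "x \<in> ?U" by (simp add: algebra_simps)
        moreover have "x \<notin> T"
        proof
          assume "x \<in> T"
          then have "x + - (x - z) \<in> T" using TQ add_subgroup_minus[OF Q x] by blast
          then show False using NT z by auto
        qed
        ultimately show "x \<in> ?U - T" by simp
      qed
      have Nz1: "z - z1 \<in> Q" if z: "z \<in> N" for z
      proof (rule ccontr)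
        assume nin: "z - z1 \<notin> Q"
        have "x - z1 \<notin> Q" if "x - z \<in> Q" for x
          using add_subgroup_diff[OF Q _ that, of "x - z1"] nin by auto
        then have "{x. x - z \<in> Q} \<inter> {x. x - z1 \<in> Q} = {}" by blast
        then have "card ({x. x - z \<in> Q} \<union> {x. x - z1 \<in> Q}) = 2 * card Q"
          by (subst card_Un_disjoint) (auto simp: card_coset)
        moreover have "card ({x. x - z \<in> Q} \<union> {x. x - z1 \<in> Q}) \<le> card (?U - T)"
          using coset[OF z] coset[OF z1] by (intro card_mono) auto
        ultimately show False using card_compl card_TQ cards False by linarith
      qed
      have "Q \<noteq> H"
      proof
        assume "Q = H"
        have "(z1 - (u + v)) - (t - (u + v)) \<in> H"
          using add_subgroup_diff[OF H] NH TU z1 t by blast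
        then have "z1 - t \<in> Q" using \<open>Q = H\<close> by (simp add: algebra_simps)
        then have "t + (z1 - t) \<in> T" by (rule TQ[OF t])
        then show False using NT z1 by auto
      qed
      then have lt: "card Q < card H" using QH by (intro psubset_card_mono) auto
      \<comment> \<open>\<open>E\<close> is what \<open>C\<close> and \<open>z1 - D\<close> cover,
        so \<open>l\<close> points of \<open>u + H\<close> remain. The induction hypothesis is
        applied around such a point \<open>x\<close>: to \<open>C\<close> in \<open>x + Q\<close>
        and to \<open>D\<close> in the mirrored coset \<open>z1 - x + Q\<close>, whose sums lie in
        \<open>z1 + Q\<close>, the coset containing \<open>N\<close>.\<close>
      define E where "E = C \<union> (\<lambda>d. z1 - d) ` D"
      have disj: "C \<inter> (\<lambda>d. z1 - d) ` D = {}"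
        using bspec[OF bspec[OF avoid z1]] by fastforce
      then have card_E: "card E = card C + card D"
        by (simp add: E_def card_Un_disjoint card_image inj_on_def)
      have EH: "E \<subseteq> {x. x - u \<in> H}"
      proof
        fix x assume "x \<in> E"
        then consider "x \<in> C" | d where "d \<in> D" "x = z1 - d" by (auto simp: E_def)
        then show "x \<in> {x. x - u \<in> H}"
        proof cases
          case 1
          then show ?thesis using CH by auto
        next
          case 2
          then have "(z1 - (u + v)) - (d - v) \<in> H"
            using add_subgroup_diff[OF H] NH z1 DH by blast
          then show ?thesis unfolding 2(2) by (simp add: algebra_simps)
        qed
      qed
      have card_HE: "card ({x. x - u \<in> H} - E) = l"
        using card_Diff_subset[of E "{x. x - u \<in> H}"] EH card_E cards card_coset[of u H] by simp
      then obtain x where x: "x - u \<in> H" "x \<notin> E" using l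
        by (metis (no_types, lifting) Diff_iff card.empty ex_in_conv less_irrefl mem_Collect_eq)
      let ?C = "C \<inter> {y. y - x \<in> Q}"
      let ?D = "D \<inter> {y. y - (z1 - x) \<in> Q}"
      let ?I = "{y. y - x \<in> Q}"
      have flip: "(z1 - d) - x \<in> Q \<longleftrightarrow> d - (z1 - x) \<in> Q" for d
        using add_subgroup_minus[OF Q, of "(z1 - d) - x"]
          add_subgroup_minus[OF Q, of "d - (z1 - x)"] by (auto simp: algebra_simps)
      have "E \<inter> ?I = ?C \<union> (\<lambda>d. z1 - d) ` ?D" using flip by (auto simp: E_def)
      moreover have "?C \<inter> (\<lambda>d. z1 - d) ` ?D = {}" using disj by blast
      ultimately have card_EI: "card (E \<inter> ?I) = card ?C + card ?D"
        by (simp add: card_Un_disjoint card_image inj_on_def)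
      \<comment> \<open>The free points within \<open>x + Q\<close>: \<open>x\<close> itself is one,
        and all of them are among the \<open>l\<close> free points of \<open>u + H\<close>, so
        \<open>0 < l' \<le> l\<close>.\<close>
      define l' where "l' = card (?I - E)"
      have "card (E \<inter> ?I) + l' = card Q"
        using card_Int_Diff[of ?I E] by (simp add: l'_def card_coset Int_commute)
      then have cards': "card ?C + card ?D + l' = card Q" using card_EI by simp
      have "x \<in> ?I - E" using x add_subgroup_zero[OF Q] by simp
      then have "?I - E \<noteq> {}" by blast
      then have l': "l' > 0" by (simp add: l'_def card_gt_0_iff)
      have "?I - E \<subseteq> {x. x - u \<in> H} - E"
        using add_subgroup_add[OF H, of _ "x - u"] x QH by force
      then have "l' \<le> l" using card_HE card_mono[of "{x. x - u \<in> H} - E" "?I - E"]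
        by (simp add: l'_def)
      have "card N \<le> 2 * l' \<or> (\<exists>y. y - x \<in> Q \<and> y \<notin> ?C \<and> (\<forall>z\<in>N. z - y \<notin> ?D)) \<or>
           (\<exists>y. y - (z1 - x) \<in> Q \<and> y \<notin> ?D \<and> (\<forall>z\<in>N. z - y \<notin> ?C))"
        by (rule less.hyps[OF lt Q _ _ _ _ cards' l']) (use Nz1 avoid in auto)
      then consider "card N \<le> 2 * l'"
        | y where "y - x \<in> Q" "y \<notin> ?C" "\<forall>z\<in>N. z - y \<notin> ?D"
        | y where "y - (z1 - x) \<in> Q" "y \<notin> ?D" "\<forall>z\<in>N. z - y \<notin> ?C" by blast
      then show ?thesis
      proof cases
        case 1
        then show ?thesis using \<open>l' \<le> l\<close> by simp
      next
        case 2
        \<comment> \<open>Since \<open>z\<close> lies in \<open>z1 + Q\<close> and \<open>y\<close>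
          in \<open>x + Q\<close>, the difference lies in the coset to which \<open>?D\<close>
          restricts \<open>D\<close>; being outside \<open>?D\<close> thus means being outside
          \<open>D\<close>.\<close>
        have "z - y \<notin> D" if "z \<in> N" for z
          using 2 that add_subgroup_diff[OF Q Nz1[OF that] 2(1)] by (auto simp: algebra_simps)
        moreover have "(y - x) + (x - u) \<in> H" using 2 QH x add_subgroup_add[OF H] by blast
        ultimately show ?thesis using 2 by auto
      next
        case 3
        have "z - y \<notin> C" if "z \<in> N" for z
          using 3 that add_subgroup_diff[OF Q Nz1[OF that] 3(1)] by (auto simp: algebra_simps)
        moreover have "(y - (z1 - x)) + ((z1 - (u + v)) - (x - u)) \<in> H"
          using 3 QH x NH z1 add_subgroup_add[OF H] add_subgroup_diff[OF H] by blast
        then have "y - v \<in> H" by (simp add: algebra_simps)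
        ultimately show ?thesis using 3 by auto
      qed
    qed
  qed
  ultimately show ?case by blast
qed

section \<open>Bounding W by 2|F| within one coset of 2G\<close>

lemma periodic_avoided_sums_bound:
  fixes C D F W :: "'a::{ab_group_add, finite} set"
  assumes part: "\<And>w x. w \<in> W \<Longrightarrow> x - w \<in> F \<longleftrightarrow> x \<notin> C \<and> z0 + (w + w) - x \<notin> D"
    and disj: "\<And>w x. w \<in> W \<Longrightarrow> x \<in> C \<Longrightarrow> z0 + (w + w) - x \<notin> D"
    and "0 \<in> W" and "F \<noteq> {}"
    and period: "\<And>d r. d \<in> D \<Longrightarrow> r \<in> stabilizer F \<Longrightarrow> d + r \<in> D"
  shows "card W \<le> 2 * card F"
proof -
  let ?R = "stabilizer F"
  note R = add_subgroup_stabilizer[of F]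
  have period_iff: "d + r \<in> D \<longleftrightarrow> d \<in> D" if "r \<in> ?R" for d r
    using period[of d r] period[of "d + r" "- r"] that add_subgroup_minus[OF R] by auto
  \<comment> \<open>Different \<open>w\<close> may give the same sum \<open>z0 + (w + w)\<close>.
    Taking full \<open>?R\<close>-cosets of the sums compensates for this loss, and periodicity of
    \<open>D\<close> keeps the enlarged set disjoint from \<open>C + D\<close>.\<close>
  define N where "N = (\<lambda>(w, r). z0 + (w + w) + r) ` (W \<times> ?R)"
  have avoid: "\<forall>z\<in>N. \<forall>c\<in>C. z - c \<notin> D"
  proof (intro ballI)
    fix z c assume "z \<in> N" "c \<in> C"
    then obtain w r where "w \<in> W" "r \<in> ?R" "z = z0 + (w + w) + r" by (auto simp: N_def)
    then have "z - c = (z0 + (w + w) - c) + r" by (simp add: algebra_simps)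
    then show "z - c \<notin> D"
      using disj[OF \<open>w \<in> W\<close> \<open>c \<in> C\<close>] period_iff[OF \<open>r \<in> ?R\<close>] by metis
  qed
  have WN: "z0 + (w + w) \<in> N" if "w \<in> W" for w
    using that add_subgroup_zero[OF R] by (force simp: N_def)
  \<comment> \<open>The case \<open>w = 0\<close> splits the group into \<open>C\<close>,
    \<open>z0 - D\<close> and \<open>F\<close>. This is the cardinality hypothesis of
    \<open>avoided_sums_bound\<close> for the whole group, with \<open>l = card F\<close>.\<close>
  have "UNIV = (C \<union> (\<lambda>d. z0 - d) ` D) \<union> F"
    using part[OF \<open>0 \<in> W\<close>] by (auto simp: image_iff) (metis diff_diff_eq2 add_diff_cancel_left')
  then have "CARD('a) = card ((C \<union> (\<lambda>d. z0 - d) ` D) \<union> F)" by metis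
  moreover have "C \<inter> (\<lambda>d. z0 - d) ` D = {}" by (auto dest!: disj[OF \<open>0 \<in> W\<close>])
  moreover have "(C \<union> (\<lambda>d. z0 - d) ` D) \<inter> F = {}" using part[OF \<open>0 \<in> W\<close>] by auto
  ultimately have "CARD('a) = card C + card D + card F"
    by (simp add: card_Un_disjoint card_image inj_on_def)
  then have "card N \<le> 2 * card F \<or> (\<exists>x. x - 0 \<in> UNIV \<and> x \<notin> C \<and> (\<forall>z\<in>N. z - x \<notin> D)) \<or>
           (\<exists>y. y - 0 \<in> UNIV \<and> y \<notin> D \<and> (\<forall>z\<in>N. z - y \<notin> C))"
    using avoid \<open>F \<noteq> {}\<close>
    by (intro avoided_sums_bound) (auto simp: add_subgroup_def card_gt_0_iff)
  then consider "card N \<le> 2 * card F" | x where "x \<notin> C" "\<forall>z\<in>N. z - x \<notin> D"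
    | y where "y \<notin> D" "\<forall>z\<in>N. z - y \<notin> C" by blast
  then show ?thesis
  proof cases
    case 1
    \<comment> \<open>If the doubles agree modulo \<open>?R\<close>, periodicity of \<open>D\<close>
      makes the two reflected copies of \<open>D\<close> equal, hence
      \<open>w + F = w' + F\<close>.\<close>
    have inj_mod: "w - w' \<in> ?R"
      if w: "w \<in> W" "w' \<in> W" and ww: "(w + w) - (w' + w') \<in> ?R" for w w'
    proof -
      have "x - w \<in> F \<longleftrightarrow> x - w' \<in> F" for x
      proof -
        have "z0 + (w + w) - x = (z0 + (w' + w') - x) + ((w + w) - (w' + w'))"
          by (simp add: algebra_simps)
        then show ?thesis using part[OF w(1)] part[OF w(2)] period_iff[OF ww] by metis
      qed
      then have "(x + w) - w \<in> F \<longleftrightarrow> (x + w) - w' \<in> F" for x by blast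
      then show ?thesis by (simp add: stabilizer_def algebra_simps)
    qed
    \<comment> \<open>\<open>p z\<close> is a reference element of \<open>W\<close> whose sum agrees
      with \<open>z\<close> modulo \<open>?R\<close>. By \<open>inj_mod\<close> every other such
      \<open>w\<close> differs from it by an element of \<open>?R\<close>, so \<open>?f\<close>
      embeds \<open>W \<times> ?R\<close> into \<open>N \<times> ?R\<close>, and
      \<open>card W \<le> card N\<close> follows.\<close>
    define p where "p z = (SOME w. w \<in> W \<and> z - (z0 + (w + w)) \<in> ?R)" for z
    let ?f = "\<lambda>(w, r). (z0 + (w + w) + r, w - p (z0 + (w + w) + r))"
    have p: "w - p (z0 + (w + w) + r) \<in> ?R" if w: "w \<in> W" "r \<in> ?R" for w r
    proof -
      let ?z = "z0 + (w + w) + r"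
      have "w \<in> W \<and> ?z - (z0 + (w + w)) \<in> ?R" using w by simp
      then have pz: "p ?z \<in> W \<and> ?z - (z0 + (p ?z + p ?z)) \<in> ?R"
        unfolding p_def by (rule someI)
      then have "(?z - (z0 + (p ?z + p ?z))) - r \<in> ?R" using add_subgroup_diff[OF R] w by blast
      then have "(w + w) - (p ?z + p ?z) \<in> ?R" by (simp add: algebra_simps)
      then show ?thesis using inj_mod w pz by blast
    qed
    have "inj_on ?f (W \<times> ?R)"
    proof (rule inj_onI, clarify)
      fix w r w' r'
      assume z: "z0 + (w + w) + r = z0 + (w' + w') + r'"
        and "w - p (z0 + (w + w) + r) = w' - p (z0 + (w' + w') + r')"
      then have "w = w'" by (simp only: z) simp
      then show "w = w' \<and> r = r'" using z by simp
    qed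
    moreover have "?f ` (W \<times> ?R) \<subseteq> N \<times> ?R" using p by (auto simp: N_def)
    ultimately have "card (W \<times> ?R) \<le> card (N \<times> ?R)" by (rule card_inj_on_le) simp
    moreover have "card ?R > 0" using add_subgroup_zero[OF R] by (auto simp: card_gt_0_iff)
    ultimately have "card W \<le> card N" by (simp add: card_cartesian_product)
    then show ?thesis using 1 by simp
  next
    case 2
    \<comment> \<open>The point \<open>x\<close> lies in every translate
      \<open>w + F\<close>.\<close>
    have "(\<lambda>w. x - w) ` W \<subseteq> F" using 2 part WN by auto
    then have "card W \<le> card F"
      by (rule card_inj_on_le[rotated]) (auto simp: inj_on_def)
    then show ?thesis by simp
  next
    case 3
    \<comment> \<open>Here the varying point \<open>z0 + (w + w) - y\<close> lies in
      \<open>w + F\<close>.\<close>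
    have "z0 + w - y \<in> F" if "w \<in> W" for w
      using part[OF that, of "z0 + (w + w) - y"] 3 WN[OF that] by (simp add: algebra_simps)
    then have "(\<lambda>w. z0 + w - y) ` W \<subseteq> F" by auto
    then have "card W \<le> card F"
      by (rule card_inj_on_le[rotated]) (auto simp: inj_on_def)
    then show ?thesis by simp
  qed
qed

text \<open>Reduction to periodic \<open>D\<close>: replace \<open>C\<close> by the largest
  \<open>?R\<close>-periodic subset \<open>C'\<close> and \<open>D\<close> by
  \<open>D' = D + ?R\<close>. Each \<open>w + F\<close> is \<open>?R\<close>-periodic, so it stays
  the exact complement: a point lost by \<open>C\<close> has some \<open>?R\<close>-translate
  outside both \<open>C\<close> and \<open>w + F\<close>, hence in \<open>z0 + (w + w) - D\<close>,
  and so is covered by the enlarged \<open>D'\<close>.\<close>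

lemma disjoint_cover_bound:
  fixes C D F W :: "'a::{ab_group_add, finite} set"
  assumes part: "\<And>w x. w \<in> W \<Longrightarrow> x - w \<in> F \<longleftrightarrow> x \<notin> C \<and> z0 + (w + w) - x \<notin> D"
    and disj: "\<And>w x. w \<in> W \<Longrightarrow> x \<in> C \<Longrightarrow> z0 + (w + w) - x \<notin> D"
    and "0 \<in> W" and "F \<noteq> {}"
  shows "card W \<le> 2 * card F"
proof -
  let ?R = "stabilizer F"
  note R = add_subgroup_stabilizer[of F]
  define C' where "C' = {x. \<forall>r\<in>?R. x + r \<in> C}"
  define D' where "D' = {x. \<exists>r\<in>?R. x - r \<in> D}"
  have shift: "x + r - w \<in> F \<longleftrightarrow> x - w \<in> F" if "r \<in> ?R" for x r w
  proof -
    have "(x - w) + r \<in> F \<longleftrightarrow> x - w \<in> F" using that unfolding stabilizer_def by blast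
    then show ?thesis by (simp add: algebra_simps)
  qed
  show ?thesis
  proof (rule periodic_avoided_sums_bound[of W F C' z0 D'])
    fix w x assume w: "w \<in> W"
    have eq: "z0 + (w + w) - x - r = z0 + (w + w) - (x + r)" for r by simp
    show "x - w \<in> F \<longleftrightarrow> x \<notin> C' \<and> z0 + (w + w) - x \<notin> D'"
    proof
      assume "x - w \<in> F"
      then have "x + r \<notin> C \<and> z0 + (w + w) - x - r \<notin> D" if "r \<in> ?R" for r
        using part[OF w, of "x + r"] shift[OF that] by (simp add: eq)
      then show "x \<notin> C' \<and> z0 + (w + w) - x \<notin> D'"
        using add_subgroup_zero[OF R] by (auto simp: C'_def D'_def)
    next
      assume a: "x \<notin> C' \<and> z0 + (w + w) - x \<notin> D'"
      then obtain r where r: "r \<in> ?R" "x + r \<notin> C" by (auto simp: C'_def)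
      have "z0 + (w + w) - (x + r) \<notin> D" using a r unfolding D'_def eq[symmetric] by blast
      then show "x - w \<in> F" using part[OF w, of "x + r"] r shift by blast
    qed
    show "z0 + (w + w) - x \<notin> D'" if "x \<in> C'"
    proof -
      have "z0 + (w + w) - x - r \<notin> D" if "r \<in> ?R" for r
        unfolding eq using \<open>x \<in> C'\<close> that by (intro disj[OF w]) (simp add: C'_def)
      then show ?thesis by (auto simp: D'_def)
    qed
  next
    fix d r assume "d \<in> D'" and r: "r \<in> ?R"
    then obtain s where s: "s \<in> ?R" "d - s \<in> D" by (auto simp: D'_def)
    then have "r + s \<in> ?R" "d + r - (r + s) \<in> D"
      using add_subgroup_add[OF R r s(1)] by (auto simp: algebra_simps)
    then show "d + r \<in> D'" unfolding D'_def by blast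
  qed (use assms in auto)
qed

section \<open>The extremal hypothesis and averaging over cosets of 2G\<close>

lemma L_at_eq: "L_at S z = card {x :: 'a::{ab_group_add, finite}. x + x - z \<in> S}"
proof -
  have "{(x, y). x + y = z \<and> x - y \<in> S} = (\<lambda>x. (x, z - x)) ` {x. x + x - z \<in> S}"
    by (auto simp: image_iff algebra_simps)
  then show ?thesis by (simp add: L_at_def card_image inj_on_def)
qed

text \<open>Double counting of the pairs \<open>(z, w)\<close>: each fixed \<open>w\<close> admits
  exactly \<open>card X\<close> values of \<open>z\<close>. Summing over all \<open>z\<close> thus
  averages over the cosets of 2G without choosing representatives.\<close>

lemma sum_card_double_shift:
  fixes X :: "'a::{ab_group_add, finite} set"
  shows "(\<Sum>z\<in>UNIV. card {w. z + (w + w) \<in> X}) = CARD('a) * card X"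
proof -
  have fib: "card {z. z + (w + w) \<in> X} = card X" for w
    using card_coset[of "- (w + w)" X] by (simp only: diff_minus_eq_add)
  have "(\<Sum>z\<in>UNIV. card {w. z + (w + w) \<in> X}) = card (SIGMA z:UNIV. {w. z + (w + w) \<in> X})"
    by simp
  also have "\<dots> = card (SIGMA w:UNIV. {z. z + (w + w) \<in> X})"
    by (rule bij_betw_same_card[of prod.swap]) (auto simp: bij_betw_def inj_on_def image_iff)
  also have "\<dots> = CARD('a) * card X" by (simp add: fib)
  finally show ?thesis .
qed

text \<open>As \<open>z\<close> is not a restricted sum, \<open>A \<inter> (z - B)\<close> lies in
  X(z), which has at most \<open>L_max S\<close> elements, while the union has at most
  \<open>CARD('a)\<close>. The two sizes add up to \<open>card A + card B\<close>, so both bounds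
  are attained and the inclusion is an equality.\<close>

lemma restricted_sumset_complement:
  fixes A B S :: "'a::{ab_group_add, finite} set"
  assumes cards: "card A + card B = CARD('a) + L_max S" and z: "z \<notin> restricted_sumset S A B"
  shows "{x \<in> A. z - x \<in> B} = {x. x + x - z \<in> S}" and "A \<union> {x. z - x \<in> B} = UNIV"
    and "card {x. x + x - z \<in> S} = L_max S"
proof -
  let ?B = "{x. z - x \<in> B}"
  let ?X = "{x. x + x - z \<in> S}"
  have "?B = (\<lambda>b. z - b) ` B" by (auto simp: image_iff) (metis diff_diff_eq2 add_diff_cancel_left')
  then have cB: "card ?B = card B" by (simp add: card_image inj_on_def)
  have sub: "A \<inter> ?B \<subseteq> ?X"
  proof
    fix x assume "x \<in> A \<inter> ?B"
    then have "x - (z - x) \<in> S" using z unfolding restricted_sumset_def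
      by (smt (verit) IntE add_diff_cancel_left' diff_add_cancel add.commute mem_Collect_eq)
    then show "x \<in> ?X" by (simp add: algebra_simps)
  qed
  have le: "card ?X \<le> L_max S" by (simp add: L_at_eq[symmetric] L_max_def)
  have un: "card (A \<union> ?B) \<le> CARD('a)" by (simp add: card_mono)
  have "card (A \<union> ?B) + card (A \<inter> ?B) = CARD('a) + L_max S"
    using card_Un_Int[of A ?B] cB cards by simp
  moreover have "card (A \<inter> ?B) \<le> card ?X" using sub by (simp add: card_mono)
  ultimately have eqs: "card (A \<union> ?B) = CARD('a)" "card (A \<inter> ?B) = card ?X" "card ?X = L_max S"
    using le un by linarith+
  show "card ?X = L_max S" by (fact eqs)
  show "A \<union> ?B = UNIV" using eqs card_subset_eq[of UNIV "A \<union> ?B"] by simp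
  have "A \<inter> ?B = ?X" using sub eqs by (intro card_subset_eq) auto
  then show "{x \<in> A. z - x \<in> B} = ?X" by blast
qed

theorem theorem12:
  fixes A B S :: "'a::{ab_group_add, finite} set"
  assumes "A \<noteq> {}" and "B \<noteq> {}" and "S \<noteq> {}"
    and "card A + card B = CARD('a) + L_max S"
  shows "int (card (restricted_sumset S A B)) \<ge> int CARD('a) - 2 * int (card S)"
proof -
  define M where "M = - restricted_sumset S A B"
  obtain s where "s \<in> S" using assms by blast
  \<comment> \<open>The pair \<open>(s, 0)\<close> has sum and difference \<open>s\<close>. The
    resulting positivity of \<open>L_max S\<close> makes \<open>?F\<close> nonempty below.\<close>
  then have "s \<in> {x. x + x - s \<in> S}" by simp
  then have "{x. x + x - s \<in> S} \<noteq> {}" by blast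
  then have "L_at S s > 0" by (simp add: L_at_eq card_gt_0_iff)
  moreover have "L_at S s \<le> L_max S" by (simp add: L_max_def)
  ultimately have L: "L_max S > 0" by simp
  have at_M: "card {w. z0 + (w + w) \<in> M} \<le> 2 * card {w. z0 + (w + w) \<in> S}" if "z0 \<in> M" for z0
  proof -
    let ?F = "{x. x + x - z0 \<in> S}"
    note compl = restricted_sumset_complement[OF assms(4)]
    \<comment> \<open>That is, \<open>w + ?F\<close> is X(z0 + 2w), so a single set
      \<open>?F\<close> describes the whole coset of 2G through \<open>z0\<close>.\<close>
    have F: "x - w \<in> ?F \<longleftrightarrow> x + x - (z0 + (w + w)) \<in> S" for x w
      by (simp add: algebra_simps)
    have "card ?F > 0" using compl(3)[of z0] that L by (simp add: M_def)
    then have "?F \<noteq> {}" by force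
    then have "card {w. z0 + (w + w) \<in> M} \<le> 2 * card ?F"
    proof (rule disjoint_cover_bound[of _ _ "- A" z0 "- B", rotated 3])
      fix w x assume "w \<in> {w. z0 + (w + w) \<in> M}"
      then have w: "z0 + (w + w) \<notin> restricted_sumset S A B" by (simp add: M_def)
      show "x - w \<in> ?F \<longleftrightarrow> x \<notin> - A \<and> z0 + (w + w) - x \<notin> - B"
        using compl(1)[OF w] unfolding F by blast
      show "x \<in> - A \<Longrightarrow> z0 + (w + w) - x \<notin> - B"
        using compl(2)[OF w] by blast
    qed (use that in simp)
    \<comment> \<open>Substituting \<open>x = w + z0\<close> turns \<open>x + x - z0\<close> into
      \<open>z0 + (w + w)\<close>.\<close>
    moreover have "card ?F = card {w. z0 + (w + w) \<in> S}"
      using card_coset[of z0 "{w. z0 + (w + w) \<in> S}"] by (simp add: algebra_simps)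
    ultimately show ?thesis by simp
  qed
  have "card {w. z + (w + w) \<in> M} \<le> 2 * card {w. z + (w + w) \<in> S}" for z
  proof (cases "{w. z + (w + w) \<in> M} = {}")
    case False
    then obtain v where v: "z + (v + v) \<in> M" by blast
    \<comment> \<open>Both counts depend only on the coset of 2G containing \<open>z\<close>, so the
      base point can be moved into \<open>M\<close> whenever that coset meets
      \<open>M\<close>.\<close>
    have "card {w. z + (v + v) + (w + w) \<in> X} = card {w. z + (w + w) \<in> X}" for X
      using card_coset[of "- v" "{w. z + (w + w) \<in> X}"] by (simp add: algebra_simps)
    then show ?thesis using at_M[OF v] by metis
  qed simp
  then have "(\<Sum>z\<in>UNIV. card {w. z + (w + w) \<in> M})
      \<le> (\<Sum>z\<in>UNIV. 2 * card {w. z + (w + w) \<in> S})"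
    by (intro sum_mono)
  then have "CARD('a) * card M \<le> CARD('a) * (2 * card S)"
    by (simp only: sum_distrib_left[symmetric] sum_card_double_shift mult.left_commute)
  then have "card M \<le> 2 * card S" by simp
  moreover have "card M + card (restricted_sumset S A B) = CARD('a)"
    by (simp add: M_def Compl_eq_Diff_UNIV card_Diff_subset card_mono)
  ultimately show ?thesis by linarith
qed

end
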